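(* Let $p$ be an odd prime, $d\ge1$ an integer such that $-1$ is a power of $p$ modulo $2d$, $t$ the smallest positive integer with $p^t\equiv-1\pmod{2d}$, and $q=p^{4t}$. Let $I\subset\{0,\dots,2d-1\}$ with $|I|=d$, $0\in I$ and $I\neq\{0,2,\dots,2d-2\}$, and let $X=PP(q,2d,I)$. Then the number of cliques in $X$ of size $\sqrt{q}$ that are $\mathbb{F}_{p^t}$-linear subspaces of $\mathbb{F}_q$ containing $1$ is even (possibly zero). Furthermore, these cliques come in pairs that are interchanged by the map $x\mapsto x^{\sqrt{q}}$.
   Context: $g$ is a fixed primitive root of $\mathbb{F}_q$; the $2d$-th cyclotomic classes are $C_j=g^j\langle g^{2d}\rangle$ (indices mod $2d$). For $I=\{m_1,\dots,m_d\}$, $PP(q,2d,I)$ is the Cayley graph on vertex set $\mathbb{F}_q$ with $x\sim y$ iff $x-y\in\bigcup_{j=1}^d C_{m_j}$. *)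

theory Defs
  imports
    "HOL-Library.Cardinality"
    "HOL-Number_Theory.Number_Theory"
    "Graph_Theory.Graph_Theory"
begin

definition cyclic_subgroup :: "'a::field \<Rightarrow> 'a set" where
  "cyclic_subgroup h = range (\<lambda>k::int. h powi k)"

definition is_primitive_root :: "'a::field \<Rightarrow> bool" where
  "is_primitive_root g \<longleftrightarrow> cyclic_subgroup g = UNIV - {0}"

definition cyclotomic_class :: "'a::field \<Rightarrow> nat \<Rightarrow> nat \<Rightarrow> 'a set" where
  "cyclotomic_class g n j = (\<lambda>x. g ^ j * x) ` cyclic_subgroup (g ^ n)"

definition cayley_graph :: "'a::ab_group_add set \<Rightarrow> 'a pair_pre_digraph" where
  "cayley_graph S = \<lparr> pverts = UNIV, parcs = {(x, y). x - y \<in> S} \<rparr>"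

text \<open>
  For a primitive root \<open>g\<close> of the field with \<open>q\<close> elements, \<open>PP g n I\<close> is the graph usually
  written \<open>PP(q, n, I)\<close>; the field is given by the type and the choice of \<open>g\<close> is explicit.
\<close>

definition PP :: "'a::field \<Rightarrow> nat \<Rightarrow> nat set \<Rightarrow> 'a pair_pre_digraph" where
  "PP g n I = cayley_graph (\<Union>j\<in>I. cyclotomic_class g n j)"

definition is_clique :: "'a pair_pre_digraph \<Rightarrow> 'a set \<Rightarrow> bool" where
  "is_clique G V \<longleftrightarrow>
     V \<subseteq> pverts G \<and> (\<forall>x\<in>V. \<forall>y\<in>V. x \<noteq> y \<longrightarrow> (x, y) \<in> parcs G)"

definition is_subfield :: "'a::field set \<Rightarrow> bool" where
  "is_subfield K \<longleftrightarrow>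
     0 \<in> K \<and> 1 \<in> K \<and>
     (\<forall>x\<in>K. \<forall>y\<in>K. x + y \<in> K \<and> x * y \<in> K) \<and>
     (\<forall>x\<in>K. - x \<in> K \<and> inverse x \<in> K)"

definition is_linear_subspace :: "'a::field set \<Rightarrow> 'a set \<Rightarrow> bool" where
  "is_linear_subspace K V \<longleftrightarrow>
     0 \<in> V \<and> (\<forall>x\<in>V. \<forall>y\<in>V. x + y \<in> V) \<and> (\<forall>c\<in>K. \<forall>x\<in>V. c * x \<in> V)"

definition subspace_cliques ::
    "'a::field set \<Rightarrow> 'a pair_pre_digraph \<Rightarrow> nat \<Rightarrow> 'a set set" where
  "subspace_cliques K G m =
     {V. is_clique G V \<and> card V = m \<and> is_linear_subspace K V \<and> 1 \<in> V}"

end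

(*
Let Q = p^t, so that the field has Q^4 elements and 2d divides Q + 1. Since Q^2 = 1 mod 2d, the
conjugation s(x) = x^(Q^2) preserves every cyclotomic class, hence permutes the cliques in question.
Suppose V = s(V). If s is the identity on V, then V is the subfield of order Q^2, whose units are
spread over all the even classes, so I is the set of even residues. Otherwise V contains some w /= 0
with s(w) = -w. Map z to z^((Q^2 + 1)(Q - 1)), whose image is cyclic of order Q + 1: as I contains
half of the residues mod 2d, the connection set takes at most (Q + 1)/2 values. But 1 and the x + w
with x in K have norms 1 and x^2 - w^2, and w^2 does not lie in K, so the (Q + 1)/2 squares x^2 give
pairwise distinct values, all different from the value 1: a contradiction.
*)

theory Submission
  imports Defs "HOL-Computational_Algebra.Polynomial"
begin

section \<open>Counting\<close>

text \<open>Each orbit \<open>{a, f a}\<close> has exactly two elements, and deleting it leaves a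
  set that \<open>f\<close> still maps to itself, so induction applies.\<close>

lemma even_card_involution:
  assumes "finite A" "\<And>x. x \<in> A \<Longrightarrow> f x \<in> A \<and> f x \<noteq> x \<and> f (f x) = x"
  shows "even (card A)"
  using assms
proof (induction A rule: finite_psubset_induct)
  case (psubset A)
  show ?case
  proof (cases "A = {}")
    case False
    then obtain a where a: "a \<in> A" by auto
    let ?B = "A - {a, f a}"
    have "even (card ?B)"
    proof (rule psubset.IH)
      show "?B \<subset> A" using a by auto
      show "f x \<in> ?B \<and> f x \<noteq> x \<and> f (f x) = x" if "x \<in> ?B" for x
        using psubset.prems[of x] psubset.prems[of a] that a by auto
    qed
    moreover have "card A = card ?B + card {a, f a}"
      using a psubset.prems[OF a] psubset.hyps
      by (metis add.commute bot.extremum card_Diff_subset card_mono finite_subset insert_subset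
          le_add_diff_inverse)
    moreover have "card {a, f a} = 2" using psubset.prems[OF a] by auto
    ultimately show ?thesis by simp
  qed auto
qed

text \<open>Division by \<open>n\<close> splits \<open>b\<close> into a quotient below
  \<open>m\<close> and a residue in \<open>I\<close>.\<close>

lemma card_residues_le:
  fixes I :: "nat set"
  assumes "finite I"
  shows "card {b. b < m * n \<and> b mod n \<in> I} \<le> m * card I"
proof -
  have "{b. b < m * n \<and> b mod n \<in> I} \<subseteq> (\<lambda>(i, j). j + n * i) ` ({..<m} \<times> I)"
  proof
    fix b assume "b \<in> {b. b < m * n \<and> b mod n \<in> I}"
    then show "b \<in> (\<lambda>(i, j). j + n * i) ` ({..<m} \<times> I)"
      by (intro image_eqI[of _ _ "(b div n, b mod n)"]) (auto simp: less_mult_imp_div_less)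
  qed
  then have "card {b. b < m * n \<and> b mod n \<in> I} \<le> card ({..<m} \<times> I)"
    by (rule surj_card_le[rotated]) (use assms in auto)
  then show ?thesis by (simp add: card_cartesian_product)
qed

text \<open>A nonzero square has at most two roots; 0 is counted apart, which gives the summand
  1.\<close>

lemma card_squares_ge:
  fixes K :: "'a::idom set"
  assumes "finite K" "0 \<in> K"
  shows "card K + 1 \<le> 2 * card ((\<lambda>x. x ^ 2) ` K)"
proof -
  let ?L = "K - {0}" and ?sq = "\<lambda>x::'a. x ^ 2"
  have fiber: "card {x. x ^ 2 = s} \<le> 2" "finite {x. x ^ 2 = s}" if "s \<in> ?sq ` ?L" for s
  proof -
    from that obtain y where "s = y ^ 2" by auto
    then have *: "{x. x ^ 2 = s} = {y, - y}" by (auto simp: power2_eq_iff)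
    show "card {x. x ^ 2 = s} \<le> 2" "finite {x. x ^ 2 = s}"
      unfolding * by (simp_all add: card_insert_if)
  qed
  have "card ?L \<le> card (\<Union>s\<in>?sq ` ?L. {x. x ^ 2 = s})"
    by (rule card_mono) (use assms fiber in auto)
  also have "\<dots> \<le> (\<Sum>s\<in>?sq ` ?L. card {x. x ^ 2 = s})"
    by (rule card_UN_le) (use assms in auto)
  also have "\<dots> \<le> card (?sq ` ?L) * 2"
    using sum_bounded_above[of "?sq ` ?L" "\<lambda>s. card {x. x ^ 2 = s}" 2] fiber by simp
  finally have "card ?L \<le> card (?sq ` ?L) * 2" .
  moreover have "?sq ` K = insert 0 (?sq ` ?L)" using assms by (auto simp: image_iff)
  then have "card (?sq ` K) = Suc (card (?sq ` ?L))"
    using assms by (simp add: image_iff card_insert_if)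
  moreover have "card K = Suc (card ?L)"
    using assms by (metis card.remove)
  ultimately show ?thesis by simp
qed

section \<open>Finite fields\<close>

lemma CHAR_finite_field:
  assumes "prime p" "CARD('a::{field, finite}) = p ^ n"
  shows "CHAR('a) = p"
proof -
  have "prime CHAR('a)"
    by (rule prime_CHAR_semidom) (rule finite_imp_CHAR_pos, simp)
  moreover have "CHAR('a) dvd p ^ n" using CHAR_dvd_CARD[where 'a='a] assms by simp
  ultimately show ?thesis
    using assms(1) by (meson prime_dvd_power primes_dvd_imp_eq)
qed

text \<open>Multiplication by a nonzero \<open>c\<close> permutes the nonzero elements of
  \<open>K\<close>; comparing the two products yields the identity. The case \<open>K = UNIV\<close>
  serves the whole field.\<close>

lemma power_card_subfield:
  assumes "is_subfield K" "finite K" "c \<in> K"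
  shows "c ^ card K = c"
proof (cases "c = 0")
  case True
  then show ?thesis using assms by (auto simp: card_gt_0_iff)
next
  case False
  let ?L = "K - {0}"
  have "bij_betw ((*) c) ?L ?L"
  proof (rule bij_betwI[where g = "(*) (inverse c)"])
    show "(*) c \<in> ?L \<rightarrow> ?L" "(*) (inverse c) \<in> ?L \<rightarrow> ?L"
      using assms False by (auto simp: is_subfield_def)
  qed (use False in auto)
  then have "(\<Prod>x\<in>?L. c * x) = \<Prod>?L"
    by (rule prod.reindex_bij_betw)
  moreover have "(\<Prod>x\<in>?L. c * x) = c ^ card ?L * \<Prod>?L"
    by (simp add: prod.distrib)
  ultimately have "c ^ card ?L = 1" using assms by simp
  moreover have "card K = Suc (card ?L)"
    using assms by (metis card.remove is_subfield_def)
  ultimately show ?thesis by simp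
qed

lemma power_card_minus_1:
  fixes x :: "'a::{field, finite}"
  assumes "x \<noteq> 0"
  shows "x ^ (CARD('a) - 1) = 1"
proof -
  have "x ^ CARD('a) = x"
    by (rule power_card_subfield) (auto simp: is_subfield_def)
  moreover have "CARD('a) = Suc (CARD('a) - 1)"
    by (simp add: card_gt_0_iff)
  ultimately have "x * x ^ (CARD('a) - 1) = x"
    by (metis power_Suc)
  then show ?thesis using assms by simp
qed

text \<open>The fixed points are the roots of X^n - X, which has degree \<open>n\<close> because
  \<open>n > 1\<close>.\<close>

lemma card_fixed_points_power_le:
  assumes "n > 1"
  shows "finite {x::'a::idom. x ^ n = x}" "card {x::'a. x ^ n = x} \<le> n"
proof -
  let ?p = "monom 1 n - [:0, 1:] :: 'a poly"
  have eq: "{x::'a. x ^ n = x} = {x. poly ?p x = 0}"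
    by (simp add: poly_monom)
  have deg: "degree ?p = n"
    unfolding diff_conv_add_uminus using assms
    by (subst degree_add_eq_left) (simp_all add: degree_monom_eq)
  then have "?p \<noteq> 0" using assms by (metis degree_0 not_one_less_zero)
  then show "finite {x::'a. x ^ n = x}" "card {x::'a. x ^ n = x} \<le> n"
    unfolding eq using poly_roots_finite[of ?p] card_poly_roots_bound[of ?p] unfolding deg by blast+
qed

lemma frobenius_diff:
  fixes x y :: "'a::comm_ring_1"
  assumes "prime CHAR('a)" "m = CHAR('a) ^ n"
  shows "(x - y) ^ m = x ^ m - y ^ m"
  using freshmans_dream'[OF assms, of "x - y" y] by (simp add: algebra_simps)

section \<open>Cyclotomic classes in terms of exponents\<close>

text \<open>Exponents matter only modulo \<open>CARD('a) - 1\<close>, so a negative one can be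
  replaced by its remainder.\<close>

lemma cyclic_subgroup_eq_powers:
  fixes h :: "'a::{field, finite}"
  assumes "h \<noteq> 0"
  shows "cyclic_subgroup h = range (\<lambda>k::nat. h ^ k)"
proof
  let ?N = "CARD('a) - 1"
  have N: "?N > 0"
    using card_mono[of UNIV "{0, 1 :: 'a}"] by simp
  show "cyclic_subgroup h \<subseteq> range (\<lambda>k::nat. h ^ k)"
  proof
    fix x assume "x \<in> cyclic_subgroup h"
    then obtain k :: int where k: "x = h powi k" by (auto simp: cyclic_subgroup_def)
    have "h powi k = h powi (int ?N * (k div int ?N) + k mod int ?N)" by simp
    also have "\<dots> = (h powi int ?N) powi (k div int ?N) * h powi (k mod int ?N)"
      using assms by (simp only: power_int_add power_int_mult simp_thms)
    also have "h powi int ?N = 1"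
      using power_card_minus_1[OF assms] by (simp only: power_int_of_nat)
    also have "h powi (k mod int ?N) = h ^ nat (k mod int ?N)"
      using N by (metis of_nat_0_less_iff pos_mod_sign power_int_of_nat int_nat_eq not_le)
    finally show "x \<in> range (\<lambda>k::nat. h ^ k)" using k by simp
  qed
  show "range (\<lambda>k::nat. h ^ k) \<subseteq> cyclic_subgroup h"
    unfolding cyclic_subgroup_def by (metis image_subsetI power_int_of_nat rangeI)
qed

context
  fixes g :: "'a::{field, finite}"
  assumes primitive: "is_primitive_root g"
begin

lemma primitive_root_nonzero: "g \<noteq> 0"
proof -
  have "g powi 1 \<in> cyclic_subgroup g" unfolding cyclic_subgroup_def by blast
  then show ?thesis using primitive by (auto simp: is_primitive_root_def)
qed

lemma primitive_root_powers:
  assumes "x \<noteq> 0"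
  obtains b :: nat where "x = g ^ b"
  using primitive assms cyclic_subgroup_eq_powers[OF primitive_root_nonzero]
  by (auto simp: is_primitive_root_def)

lemma primitive_root_power_mod: "g ^ (b mod (CARD('a) - 1)) = g ^ b"
proof -
  have "g ^ b = g ^ ((CARD('a) - 1) * (b div (CARD('a) - 1)) + b mod (CARD('a) - 1))" by simp
  also have "\<dots> = g ^ (b mod (CARD('a) - 1))"
    unfolding power_add power_mult power_card_minus_1[OF primitive_root_nonzero] by simp
  finally show ?thesis by simp
qed

text \<open>The powers with exponent below \<open>CARD('a) - 1\<close> cover all nonzero elements,
  so by counting they are pairwise distinct.\<close>

lemma primitive_root_power_eqD:
  assumes "g ^ i = g ^ j"
  shows "[i = j] (mod (CARD('a) - 1))"
proof -
  let ?N = "CARD('a) - 1"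
  have N: "?N > 0"
    using card_mono[of UNIV "{0, 1 :: 'a}"] by simp
  have "UNIV - {0} \<subseteq> (\<lambda>b. g ^ b) ` {..<?N}"
  proof
    fix x :: 'a assume "x \<in> UNIV - {0}"
    then obtain b where "x = g ^ b" using primitive_root_powers by blast
    then show "x \<in> (\<lambda>b. g ^ b) ` {..<?N}"
      using N by (intro image_eqI[of _ _ "b mod ?N"])
        (simp_all only: primitive_root_power_mod lessThan_iff mod_less_divisor)
  qed
  then have "card (UNIV - {0 :: 'a}) \<le> card ((\<lambda>b. g ^ b) ` {..<?N})"
    by (rule card_mono[rotated]) simp
  then have "inj_on (\<lambda>b. g ^ b) {..<?N}"
    by (intro eq_card_imp_inj_on antisym card_image_le) (simp_all add: card_Diff_subset)
  moreover have "g ^ (i mod ?N) = g ^ (j mod ?N)"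
    using assms by (simp only: primitive_root_power_mod)
  ultimately show ?thesis
    using N by (auto simp: inj_on_def cong_def)
qed

text \<open>The exponent of an element is determined modulo \<open>CARD('a) - 1\<close>, hence
  modulo its divisor \<open>n\<close>, and that residue names the class.\<close>

lemma mem_cyclotomic_union_iff:
  assumes "n dvd CARD('a) - 1" "I \<subseteq> {0..<n}"
  shows "g ^ b \<in> (\<Union>j\<in>I. cyclotomic_class g n j) \<longleftrightarrow> b mod n \<in> I"
proof -
  have eq: "cyclotomic_class g n j = range (\<lambda>k. g ^ (j + n * k))" for j
    using cyclic_subgroup_eq_powers[of "g ^ n"] primitive_root_nonzero
    by (auto simp: cyclotomic_class_def power_add power_mult image_image)
  show ?thesis
  proof
    assume "g ^ b \<in> (\<Union>j\<in>I. cyclotomic_class g n j)"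
    then obtain j k where jk: "j \<in> I" "g ^ b = g ^ (j + n * k)" unfolding eq by auto
    then have "[b = j + n * k] (mod n)"
      using primitive_root_power_eqD assms(1) cong_dvd_modulus_nat by blast
    moreover have "j < n" using jk assms by auto
    ultimately show "b mod n \<in> I" using jk by (simp add: cong_def)
  next
    assume "b mod n \<in> I"
    moreover have "g ^ b = g ^ (b mod n + n * (b div n))" by simp
    ultimately show "g ^ b \<in> (\<Union>j\<in>I. cyclotomic_class g n j)" unfolding eq by blast
  qed
qed

lemma zero_notin_cyclotomic_union: "0 \<notin> (\<Union>j\<in>I. cyclotomic_class g n j)"
  using cyclic_subgroup_eq_powers[of "g ^ n"] primitive_root_nonzero
  by (auto simp: cyclotomic_class_def)

end

section \<open>Conjugation-invariant cliques\<close>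

context
  fixes g :: "'a::{field, finite}" and Q n d :: nat and I :: "nat set"
  assumes prime_char: "prime CHAR('a)" and Q_def: "Q = CHAR('a) ^ n" and odd_Q: "odd Q"
    and dvd_Q: "2 * d dvd Q + 1" and card_field: "CARD('a) = Q ^ 4"
    and prim: "is_primitive_root g" and I_sub: "I \<subseteq> {0..<2 * d}" and card_I: "card I = d"
begin

section \<open>Arithmetic of Q and of the field order\<close>

lemma Q_gt_1: "Q > 1"
proof -
  have "CARD('a) > 1" using card_mono[of UNIV "{0, 1 :: 'a}"] by simp
  then have "Q \<noteq> 1" using card_field by auto
  then show ?thesis using odd_Q by (cases Q) auto
qed

lemma two_nonzero: "(2 :: 'a) \<noteq> 0"
proof
  assume "(2 :: 'a) = 0"
  then have "of_nat 2 = (0 :: 'a)" by simp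
  then have "CHAR('a) dvd 2" by (simp only: of_nat_eq_0_iff_char_dvd)
  then have "CHAR('a) = 2" using prime_char primes_dvd_imp_eq two_is_prime_nat by blast
  then show False using odd_Q Q_gt_1 Q_def by (cases n) auto
qed

text \<open>The factors are the exponent of the norm to the subfield of order Q^2 and the order of
  the unit group of that subfield.\<close>

lemma field_order_factorization: "CARD('a) - 1 = (Q\<^sup>2 + 1) * ((Q - 1) * (Q + 1))"
  using Q_gt_1 unfolding card_field by (cases Q) (simp_all add: algebra_simps power_numeral_reduce)

lemma mem_connection_set_iff:
  "g ^ b \<in> (\<Union>j\<in>I. cyclotomic_class g (2 * d) j) \<longleftrightarrow> b mod (2 * d) \<in> I"
proof (rule mem_cyclotomic_union_iff[OF prim _ I_sub])
  show "2 * d dvd CARD('a) - 1"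
    unfolding field_order_factorization using dvd_Q by (simp only: dvd_mult)
qed

lemma power_field_order: "x \<noteq> 0 \<Longrightarrow> x ^ ((Q\<^sup>2 + 1) * ((Q - 1) * (Q + 1))) = (1 :: 'a)"
  using power_card_minus_1[of x] unfolding field_order_factorization .

text \<open>This form shows that Q^2 is 1 modulo 2d, as 2d divides Q + 1.\<close>

lemma Q_square: "Q\<^sup>2 = (Q - 1) * (Q + 1) + 1"
  using Q_gt_1 by (cases Q) (simp_all add: power2_eq_square)

section \<open>Conjugation, the field automorphism of order two\<close>

lemma conj_invol: "(x ^ Q\<^sup>2) ^ Q\<^sup>2 = (x :: 'a)"
proof -
  have "(x ^ Q\<^sup>2) ^ Q\<^sup>2 = x ^ card (UNIV :: 'a set)"
    unfolding card_field power_mult[symmetric] by (simp flip: power_add)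
  also have "\<dots> = x" by (rule power_card_subfield) (auto simp: is_subfield_def)
  finally show ?thesis .
qed

lemma Q_square_eq: "Q\<^sup>2 = CHAR('a) ^ (2 * n)"
  by (simp add: Q_def power_mult mult.commute)

lemma conj_add: "(x + y :: 'a) ^ Q\<^sup>2 = x ^ Q\<^sup>2 + y ^ Q\<^sup>2"
  by (rule freshmans_dream'[OF prime_char Q_square_eq])

lemma conj_diff: "(x - y :: 'a) ^ Q\<^sup>2 = x ^ Q\<^sup>2 - y ^ Q\<^sup>2"
  by (rule frobenius_diff[OF prime_char Q_square_eq])

text \<open>Conjugation multiplies exponents of \<open>g\<close> by Q^2, which is 1 modulo
  2d.\<close>

lemma conj_connection_set:
  assumes "x \<in> (\<Union>j\<in>I. cyclotomic_class g (2 * d) j)"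
  shows "x ^ Q\<^sup>2 \<in> (\<Union>j\<in>I. cyclotomic_class g (2 * d) j)"
proof -
  have "x \<noteq> 0" using zero_notin_cyclotomic_union[OF prim] assms by metis
  then obtain b where b: "x = g ^ b" by (rule primitive_root_powers[OF prim])
  obtain m where m: "Q + 1 = 2 * d * m" using dvd_Q by (auto elim: dvdE)
  have "b * Q\<^sup>2 = b + 2 * d * (m * (Q - 1) * b)"
    unfolding Q_square m by (simp add: algebra_simps)
  then have "(b * Q\<^sup>2) mod (2 * d) = b mod (2 * d)" by simp
  then show ?thesis
    using assms mem_connection_set_iff unfolding b power_mult[symmetric] by metis
qed

section \<open>Obstructions to invariant cliques\<close>

lemma fixed_clique_imp_even_classes:
  assumes V: "V \<subseteq> {x. x ^ Q\<^sup>2 = x}" "card V = Q\<^sup>2"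
    and S: "V - {0} \<subseteq> (\<Union>j\<in>I. cyclotomic_class g (2 * d) j)"
  shows "I = {j \<in> {0..<2 * d}. even j}"
proof -
  have Q2: "Q\<^sup>2 > 1" using Q_gt_1 by (rule one_less_power) simp
  \<comment> \<open>There are at most Q^2 fixed points, so \<open>V\<close> exhausts them and is the
    subfield of order Q^2.\<close>
  have V_eq: "V = {x. x ^ Q\<^sup>2 = x}"
    by (rule card_seteq) (use V card_fixed_points_power_le[OF Q2, where 'a='a] in auto)
  have evens: "{j \<in> {0..<2 * d}. even j} = (\<lambda>k. 2 * k) ` {..<d}"
    by (auto elim!: evenE)
  have "2 * k \<in> I" if "k < d" for k
  proof -
    \<comment> \<open>The power of \<open>g\<close> with exponent Q^2 + 1 generates the units of
      that subfield. Since Q^2 + 1 is 2 modulo 2d, the multiples by \<open>k\<close> reach every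
      even residue.\<close>
    let ?b = "(Q\<^sup>2 + 1) * k"
    have "?b * Q\<^sup>2 = ?b * ((Q - 1) * (Q + 1) + 1)"
      by (rule arg_cong[OF Q_square])
    also have "\<dots> = ?b + (Q\<^sup>2 + 1) * ((Q - 1) * (Q + 1)) * k"
      by (simp only: distrib_left distrib_right mult_1_left mult_1_right ac_simps)
    finally have "(g ^ ?b) ^ Q\<^sup>2 = g ^ ?b * (g ^ ((Q\<^sup>2 + 1) * ((Q - 1) * (Q + 1)))) ^ k"
      by (simp only: power_add power_mult[symmetric])
    then have "g ^ ?b \<in> V - {0}"
      using power_field_order primitive_root_nonzero[OF prim] by (simp add: V_eq)
    then have *: "?b mod (2 * d) \<in> I" using S mem_connection_set_iff by blast
    obtain m where m: "Q + 1 = 2 * d * m" using dvd_Q by (auto elim: dvdE)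
    have "?b = 2 * k + 2 * d * (m * (Q - 1) * k)"
      unfolding Q_square m by (simp add: algebra_simps)
    then have "?b mod (2 * d) = 2 * k" using that by simp
    with * show ?thesis by simp
  qed
  then have "(\<lambda>k. 2 * k) ` {..<d} \<subseteq> I" by auto
  \<comment> \<open>The even residues number \<open>d\<close>, as many as \<open>I\<close> has
    elements, so the inclusion is an equality.\<close>
  moreover have "card ((\<lambda>k. 2 * k) ` {..<d}) = d"
    by (subst card_image) (auto simp: inj_on_def)
  moreover have "finite I" using I_sub finite_subset by blast
  ultimately have "(\<lambda>k. 2 * k) ` {..<d} = I"
    using card_I by (intro card_subset_eq) auto
  then show ?thesis using evens by simp
qed

text \<open>
  The exponent \<open>(Q\<^sup>2 + 1) * (Q - 1)\<close> composes the norm to the subfield of order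
  \<open>Q\<^sup>2\<close> with the quotient by the multiplicative group of the subfield of order
  \<open>Q\<close>. The target is cyclic of order \<open>Q + 1\<close>, and half of it is hit by the connection set.
\<close>

lemma card_norm_quotient_le:
  "2 * card ((\<lambda>z. z ^ ((Q\<^sup>2 + 1) * (Q - 1))) ` (\<Union>j\<in>I. cyclotomic_class g (2 * d) j)) \<le> Q + 1"
    (is "2 * card (?\<phi> ` ?S) \<le> _")
proof -
  obtain m where m: "Q + 1 = m * (2 * d)" using dvd_Q by (metis dvdE mult.commute)
  \<comment> \<open>Only \<open>b mod (Q + 1)\<close> affects the image, as
    \<open>?\<phi> g ^ (Q + 1) = 1\<close>. The range below Q + 1 consists of \<open>m\<close>
    blocks of length 2d, each with \<open>d\<close> residues in \<open>I\<close>.\<close>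
  let ?B = "{b. b < m * (2 * d) \<and> b mod (2 * d) \<in> I}"
  have fin: "finite ?B" by simp
  have "?\<phi> ` ?S \<subseteq> (\<lambda>b. ?\<phi> g ^ b) ` ?B"
  proof
    fix y assume "y \<in> ?\<phi> ` ?S"
    then obtain z where z: "z \<in> ?S" "y = ?\<phi> z" by blast
    have "z \<noteq> 0" using zero_notin_cyclotomic_union[OF prim] z(1) by metis
    then obtain b where b: "z = g ^ b" by (rule primitive_root_powers[OF prim])
    have "b mod (2 * d) \<in> I" using z(1) mem_connection_set_iff b by metis
    moreover have "b mod (Q + 1) mod (2 * d) = b mod (2 * d)"
      using dvd_Q by (rule mod_mod_cancel)
    moreover have "b mod (Q + 1) < m * (2 * d)" unfolding m[symmetric] by simp
    ultimately have "b mod (Q + 1) \<in> ?B" by simp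
    moreover have "y = ?\<phi> g ^ (b mod (Q + 1))"
    proof -
      have "y = ?\<phi> g ^ b" unfolding z b power_mult[symmetric] by (simp only: mult.commute)
      also have "\<dots> = ?\<phi> g ^ ((Q + 1) * (b div (Q + 1)) + b mod (Q + 1))"
        by (simp only: mult_div_mod_eq)
      also have "\<dots> = (?\<phi> g ^ (Q + 1)) ^ (b div (Q + 1)) * ?\<phi> g ^ (b mod (Q + 1))"
        by (simp only: power_add power_mult)
      also have "?\<phi> g ^ (Q + 1) = 1"
        using power_field_order[OF primitive_root_nonzero[OF prim]]
        by (simp only: power_mult[symmetric] mult.assoc)
      finally show ?thesis by simp
    qed
    ultimately show "y \<in> (\<lambda>b. ?\<phi> g ^ b) ` ?B" by blast
  qed
  then have "card (?\<phi> ` ?S) \<le> card ?B" using surj_card_le[OF fin] by blast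
  also have "\<dots> \<le> m * d"
    using card_residues_le[of I m "2 * d"] I_sub card_I finite_subset by fastforce
  finally show ?thesis unfolding m by simp
qed

lemma no_antifixed_translates:
  assumes K: "card K = Q" "0 \<in> K" "\<And>c. c \<in> K \<Longrightarrow> c ^ Q = c"
    and w: "w \<noteq> 0" "w ^ Q\<^sup>2 = - w"
    and one: "1 \<in> (\<Union>j\<in>I. cyclotomic_class g (2 * d) j)"
    and translates: "\<And>c. c \<in> K \<Longrightarrow> c + w \<in> (\<Union>j\<in>I. cyclotomic_class g (2 * d) j)"
  shows False
proof -
  let ?S = "\<Union>j\<in>I. cyclotomic_class g (2 * d) j"
  let ?\<phi> = "\<lambda>z :: 'a. z ^ ((Q\<^sup>2 + 1) * (Q - 1))" and ?sq = "\<lambda>x :: 'a. x ^ 2"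
  \<comment> \<open>\<open>\<psi>\<close> is the value of \<open>?\<phi>\<close> at
    \<open>c + w\<close> as a function of \<open>s = c ^ 2\<close>; \<open>c\<close> and
    \<open>- c\<close> share this value, so injectivity can hold only on squares.\<close>
  define \<psi> where "\<psi> = (\<lambda>s. (s - w ^ 2) ^ (Q - 1))"
  \<comment> \<open>Elements that are trivial in the quotient lie in the subfield of order
    Q.\<close>
  have fixedI: "r ^ Q = r" if "r ^ (Q - 1) = 1" for r :: 'a
    using that Q_gt_1 power_Suc[of r "Q - 1"] by simp
  \<comment> \<open>Otherwise \<open>w ^ Q\<close> is \<open>w\<close> or \<open>- w\<close>. As Q
    is odd, applying the power again returns \<open>w\<close> either way, whereas \<open>w\<close>
    is negated by conjugation.\<close>
  have u: "(w ^ 2) ^ Q \<noteq> w ^ 2"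
  proof
    assume "(w ^ 2) ^ Q = w ^ 2"
    then have "(w ^ Q) ^ 2 = w ^ 2" by (simp add: power_mult[symmetric] mult.commute)
    then have "w ^ Q = w \<or> w ^ Q = - w" by (simp add: power2_eq_iff)
    then have "(w ^ Q) ^ Q = w" using odd_Q by auto
    then have "w ^ Q\<^sup>2 = w" by (simp add: power_mult[symmetric] power2_eq_square)
    then have "2 * w = 0" using w by (metis add.right_inverse mult_2)
    then show False using two_nonzero w by simp
  qed
  have sq: "s ^ Q = s" if "s \<in> ?sq ` K" for s
  proof -
    from that obtain c where "c \<in> K" "s = c ^ 2" by auto
    then show ?thesis using K(3)[of c] by (metis mult.commute power_mult)
  qed
  have nz: "s - w ^ 2 \<noteq> 0" if "s \<in> ?sq ` K" for s
    using sq[OF that] u by auto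
  have fd: "(x - y) ^ Q = x ^ Q - y ^ Q" for x y :: 'a
    by (rule frobenius_diff[OF prime_char Q_def])
  have "inj_on \<psi> (?sq ` K)"
  proof (rule inj_onI)
    fix s s' assume s: "s \<in> ?sq ` K" and s': "s' \<in> ?sq ` K" and eq: "\<psi> s = \<psi> s'"
    define r where "r = (s - w ^ 2) / (s' - w ^ 2)"
    have "r ^ (Q - 1) = 1"
      using eq nz[OF s'] by (simp add: r_def \<psi>_def power_divide)
    then have r: "r ^ Q = r" by (rule fixedI)
    have *: "s - w ^ 2 = r * (s' - w ^ 2)" using nz[OF s'] by (simp add: r_def)
    show "s = s'"
    proof (cases "r = 1")
      case False
      \<comment> \<open>Solving for \<open>w ^ 2\<close> expresses it through \<open>r\<close>,
        \<open>s\<close> and \<open>s'\<close>, all fixed by the power Q, against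
        \<open>u\<close>.\<close>
      have "w ^ 2 * (r - 1) = r * s' - s" using * by (simp add: algebra_simps)
      then have "w ^ 2 = (r * s' - s) / (r - 1)" using False by (simp add: field_simps)
      then have "(w ^ 2) ^ Q = w ^ 2"
        using r sq[OF s] sq[OF s'] by (simp add: power_divide fd power_mult_distrib)
      then show ?thesis using u by simp
    qed (use * in simp)
  qed
  then have card_\<psi>: "card (\<psi> ` ?sq ` K) = card (?sq ` K)" by (rule card_image)
  \<comment> \<open>The value 1 would make \<open>s - w ^ 2\<close> fixed by the power Q, and with
    it \<open>w ^ 2\<close>.\<close>
  have "1 \<notin> \<psi> ` ?sq ` K"
  proof
    assume "1 \<in> \<psi> ` ?sq ` K"
    then obtain s where s: "s \<in> ?sq ` K" "\<psi> s = 1" by (metis imageE)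
    then have "(s - w ^ 2) ^ Q = s - w ^ 2" by (intro fixedI) (simp add: \<psi>_def)
    then show False using sq[OF s(1)] u by (simp add: fd)
  qed
  moreover have finK: "finite K" by simp
  ultimately have "card (insert 1 (\<psi> ` ?sq ` K)) = card (?sq ` K) + 1"
    using card_\<psi> by simp
  moreover have "insert 1 (\<psi> ` ?sq ` K) \<subseteq> ?\<phi> ` ?S"
  proof -
    have "\<psi> (c ^ 2) \<in> ?\<phi> ` ?S" if "c \<in> K" for c
    proof (rule image_eqI)
      show "c + w \<in> ?S" using translates[OF that] .
      have "c ^ Q\<^sup>2 = c" using K(3)[OF that] by (simp add: power2_eq_square power_mult)
      \<comment> \<open>Conjugation fixes \<open>c\<close> and negates \<open>w\<close>, so the norm
        of \<open>c + w\<close> is a difference of squares.\<close>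
      then have "(c + w) ^ Q\<^sup>2 = c - w" using conj_add[of c w] w by simp
      then have "(c + w) ^ (Q\<^sup>2 + 1) = (c - w) * (c + w)"
        by (simp only: power_add power_one_right)
      also have "\<dots> = c ^ 2 - w ^ 2" by (simp add: power2_eq_square algebra_simps)
      finally have "(c + w) ^ (Q\<^sup>2 + 1) = c ^ 2 - w ^ 2" .
      then show "\<psi> (c ^ 2) = ?\<phi> (c + w)" by (simp only: \<psi>_def power_mult)
    qed
    moreover have "1 \<in> ?\<phi> ` ?S" using one by (intro image_eqI[of _ _ 1]) auto
    ultimately show ?thesis by blast
  qed
  then have "card (insert 1 (\<psi> ` ?sq ` K)) \<le> card (?\<phi> ` ?S)" by (intro card_mono) auto
  \<comment> \<open>With at least (Q + 1)/2 squares, the inserted set has at least (Q + 3)/2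
    elements, but the quotient bound is (Q + 1)/2.\<close>
  moreover have "Q + 1 \<le> 2 * card (?sq ` K)" using card_squares_ge[OF finK K(2)] K(1) by simp
  ultimately show False using card_norm_quotient_le by linarith
qed

section \<open>Action of conjugation on subspace cliques\<close>

lemma PP_subspace_clique_subset:
  assumes "V \<in> subspace_cliques K (PP g (2 * d) I) m"
  shows "V - {0} \<subseteq> (\<Union>j\<in>I. cyclotomic_class g (2 * d) j)"
proof
  fix x assume "x \<in> V - {0}"
  moreover have "0 \<in> V" using assms by (simp add: subspace_cliques_def is_linear_subspace_def)
  ultimately have "(x, 0) \<in> parcs (PP g (2 * d) I)"
    using assms by (auto simp: subspace_cliques_def is_clique_def)
  then show "x \<in> (\<Union>j\<in>I. cyclotomic_class g (2 * d) j)"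
    by (simp add: PP_def cayley_graph_def)
qed

text \<open>Conjugation is additive and injective, preserves the connection set, and is
  \<open>K\<close>-linear because it fixes \<open>K\<close> pointwise.\<close>

lemma conj_subspace_clique:
  assumes V: "V \<in> subspace_cliques K (PP g (2 * d) I) m"
    and K: "\<And>c. c \<in> K \<Longrightarrow> c ^ Q = c"
  shows "(\<lambda>x. x ^ Q\<^sup>2) ` V \<in> subspace_cliques K (PP g (2 * d) I) m"
proof -
  let ?\<sigma> = "\<lambda>x :: 'a. x ^ Q\<^sup>2"
  have "inj ?\<sigma>" by (rule inj_on_inverseI[of _ ?\<sigma>]) (rule conj_invol)
  then have card: "card (?\<sigma> ` V) = card V" by (intro card_image) (auto simp: inj_on_def)
  have lin: "is_linear_subspace K V" and "1 \<in> V" and clique: "is_clique (PP g (2 * d) I) V"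
    using V by (auto simp: subspace_cliques_def)
  have "is_linear_subspace K (?\<sigma> ` V)"
    unfolding is_linear_subspace_def
  proof (intro conjI ballI)
    show "0 \<in> ?\<sigma> ` V"
      using lin Q_gt_1 by (intro image_eqI[of _ _ 0]) (auto simp: is_linear_subspace_def)
    show "x + y \<in> ?\<sigma> ` V" if "x \<in> ?\<sigma> ` V" "y \<in> ?\<sigma> ` V" for x y
      using that lin conj_add by (auto simp: is_linear_subspace_def image_iff) metis
    show "c * x \<in> ?\<sigma> ` V" if c: "c \<in> K" and x: "x \<in> ?\<sigma> ` V" for c x
    proof -
      obtain y where y: "y \<in> V" "x = y ^ Q\<^sup>2" using x by auto
      have "c ^ Q\<^sup>2 = c" using K[OF c] by (simp add: power2_eq_square power_mult)
      then have "c * x = (c * y) ^ Q\<^sup>2" by (simp add: y power_mult_distrib)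
      then show ?thesis using lin c y by (auto simp: is_linear_subspace_def)
    qed
  qed
  moreover have "is_clique (PP g (2 * d) I) (?\<sigma> ` V)"
  proof -
    have "?\<sigma> x - ?\<sigma> y \<in> (\<Union>j\<in>I. cyclotomic_class g (2 * d) j)"
      if "x \<in> V" "y \<in> V" "x \<noteq> y" for x y
    proof -
      have "x - y \<in> (\<Union>j\<in>I. cyclotomic_class g (2 * d) j)"
        using clique that unfolding is_clique_def PP_def cayley_graph_def by auto
      then show ?thesis unfolding conj_diff[symmetric] by (rule conj_connection_set)
    qed
    then show ?thesis by (auto simp: is_clique_def PP_def cayley_graph_def)
  qed
  moreover have "1 \<in> ?\<sigma> ` V" using \<open>1 \<in> V\<close> by (intro image_eqI[of _ _ 1]) auto
  ultimately show ?thesis using V card by (simp add: subspace_cliques_def)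
qed

text \<open>An invariant \<open>V\<close> is either fixed pointwise, which forces the excluded index
  set, or contains a negated \<open>w\<close> and then all translates of \<open>w\<close> by
  \<open>K\<close>.\<close>

lemma conj_subspace_clique_neq:
  assumes V: "V \<in> subspace_cliques K (PP g (2 * d) I) (Q\<^sup>2)"
    and K: "is_subfield K" "card K = Q"
    and I: "I \<noteq> {j \<in> {0..<2 * d}. even j}"
  shows "(\<lambda>x. x ^ Q\<^sup>2) ` V \<noteq> V"
proof
  assume inv: "(\<lambda>x. x ^ Q\<^sup>2) ` V = V"
  let ?S = "\<Union>j\<in>I. cyclotomic_class g (2 * d) j"
  have lin: "is_linear_subspace K V" and one: "1 \<in> V" and card: "card V = Q\<^sup>2"
    using V by (auto simp: subspace_cliques_def)
  have S: "V - {0} \<subseteq> ?S" by (rule PP_subspace_clique_subset[OF V])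
  have add: "x + y \<in> V" if "x \<in> V" "y \<in> V" for x y
    using lin that by (simp add: is_linear_subspace_def)
  have scale: "c * x \<in> V" if "c \<in> K" "x \<in> V" for c x
    using lin that by (simp add: is_linear_subspace_def)
  have "\<not> V \<subseteq> {x. x ^ Q\<^sup>2 = x}"
    using fixed_clique_imp_even_classes[OF _ card S] I by blast
  then obtain v where v: "v \<in> V" "v ^ Q\<^sup>2 \<noteq> v" by blast
  \<comment> \<open>Conjugation swaps \<open>v\<close> and its conjugate, hence negates their
    difference.\<close>
  define w where "w = v - v ^ Q\<^sup>2"
  \<comment> \<open>Subspaces are closed under sums and scaling by definition, so the difference is
    formed with the scalar -1.\<close>
  have "- 1 \<in> K" using K(1) by (simp add: is_subfield_def)
  moreover have "v ^ Q\<^sup>2 \<in> V" using v(1) inv by blast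
  ultimately have "v + (- 1) * v ^ Q\<^sup>2 \<in> V" using v(1) by (intro add scale)
  then have wV: "w \<in> V" by (simp add: w_def)
  have w: "w \<noteq> 0" "w ^ Q\<^sup>2 = - w"
    using v(2) by (simp_all add: w_def conj_diff conj_invol)
  have fixed: "c ^ Q = c" if "c \<in> K" for c
    using power_card_subfield[OF K(1) _ that] K(2) by simp
  show False
  proof (rule no_antifixed_translates[OF K(2) _ fixed w])
    show "0 \<in> K" using K(1) by (simp add: is_subfield_def)
    show "1 \<in> ?S" using one S by auto
    show "c + w \<in> ?S" if c: "c \<in> K" for c
    proof -
      have "c + w \<in> V" using add[OF scale[OF c one] wV] by simp
      \<comment> \<open>Elements of \<open>K\<close> are fixed by conjugation, while
        \<open>w\<close> is negated and 2 is nonzero.\<close>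
      moreover have "c + w \<noteq> 0"
      proof
        assume "c + w = 0"
        then have cw: "c = - w" by (simp add: eq_neg_iff_add_eq_0)
        have "c ^ Q\<^sup>2 = c" using fixed[OF c] by (simp add: power2_eq_square power_mult)
        then have "w = - w" using w odd_Q by (simp add: cw)
        then have "2 * w = 0" by (metis add.right_inverse mult_2)
        then show False using two_nonzero w by simp
      qed
      ultimately show ?thesis using S by blast
    qed
  qed
qed

end

section \<open>Existence of the exponent t and pairing of the cliques\<close>

text \<open>The hypothesis allows exponent 0, but \<open>t\<close> is minimal among positive ones.
  Exponent 0 gives 1 = -1 modulo 2d, so \<open>d = 1\<close>, and then exponent 1 works since
  \<open>p\<close> is odd.\<close>

lemma exists_positive_power_cong_minus_1:
  fixes p d :: nat
  assumes "odd p" "[int p ^ k = -1] (mod int (2 * d))"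
  shows "\<exists>s>0. [int p ^ s = -1] (mod int (2 * d))"
proof (cases "k = 0")
  case True
  then have "int (2 * d) dvd 2" using assms(2) by (simp add: cong_iff_dvd_diff)
  then have "d = 1" by (auto dest!: zdvd_imp_le)
  moreover have "even (int p + 1)" using assms(1) by simp
  ultimately have "[int p ^ 1 = -1] (mod int (2 * d))" by (simp add: cong_iff_dvd_diff)
  then show ?thesis by blast
qed (use assms in blast)

theorem theorem1p10:
  fixes g :: "'a::{field, finite}"
    and K :: "'a set"
    and p d t q :: nat
    and I :: "nat set"
    and X :: "'a pair_pre_digraph"
  assumes "prime p" and "odd p" and "d \<ge> 1"
    and "\<exists>k::nat. [int p ^ k = -1] (mod int (2 * d))"
    and "t = (LEAST s::nat. s > 0 \<and> [int p ^ s = -1] (mod int (2 * d)))"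
    and "q = p ^ (4 * t)" and "CARD('a) = q"
    and "is_primitive_root g"
    and "is_subfield K" and "card K = p ^ t"
    and "I \<subseteq> {0..<2 * d}" and "card I = d" and "0 \<in> I" and "I \<noteq> {j \<in> {0..<2 * d}. even j}"
    and "X = PP g (2 * d) I"
  shows "even (card (subspace_cliques K X (p ^ (2 * t)))) \<and>
         (\<forall>V \<in> subspace_cliques K X (p ^ (2 * t)).
            (\<lambda>x. x ^ (p ^ (2 * t))) ` V \<in> subspace_cliques K X (p ^ (2 * t)) \<and>
            (\<lambda>x. x ^ (p ^ (2 * t))) ` V \<noteq> V \<and>
            (\<lambda>x. x ^ (p ^ (2 * t))) ` ((\<lambda>x. x ^ (p ^ (2 * t))) ` V) = V)"
proof -
  let ?Q = "p ^ t"
  have "\<exists>s>0. [int p ^ s = -1] (mod int (2 * d))"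
    using exists_positive_power_cong_minus_1 assms(2,4) by blast
  then have "[int p ^ t = -1] (mod int (2 * d))"
    unfolding assms(5) by (rule LeastI2_ex) blast
  then have "int (2 * d) dvd int (?Q + 1)" by (simp add: cong_iff_dvd_diff add.commute)
  then have dvd: "2 * d dvd ?Q + 1" by (simp only: of_nat_dvd_iff)
  have card: "CARD('a) = ?Q ^ 4" using assms(6,7) by (simp add: power_mult[symmetric] mult.commute)
  have char: "CHAR('a) = p" by (rule CHAR_finite_field[OF assms(1)]) (simp add: assms(6,7))
  \<comment> \<open>The square root of \<open>q\<close> is the conjugation exponent.\<close>
  have Q2: "p ^ (2 * t) = ?Q\<^sup>2" by (simp add: power_mult[symmetric] mult.commute)
  have params: "prime CHAR('a)" "?Q = CHAR('a) ^ t" "odd ?Q" "2 * d dvd ?Q + 1" "CARD('a) = ?Q ^ 4"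
    "is_primitive_root g" "I \<subseteq> {0..<2 * d}" "card I = d"
    using assms(1,2,8,11,12) dvd card char by simp_all
  have fixed: "c ^ ?Q = c" if "c \<in> K" for c
    using power_card_subfield[OF assms(9) _ that] assms(10) by simp
  have "(\<lambda>x. x ^ ?Q\<^sup>2) ` V \<in> subspace_cliques K X (?Q\<^sup>2) \<and> (\<lambda>x. x ^ ?Q\<^sup>2) ` V \<noteq> V \<and>
      (\<lambda>x. x ^ ?Q\<^sup>2) ` ((\<lambda>x. x ^ ?Q\<^sup>2) ` V) = V"
    if "V \<in> subspace_cliques K X (?Q\<^sup>2)" for V
    using that unfolding assms(15) image_image conj_invol[OF params]
    using conj_subspace_clique[OF params _ fixed] conj_subspace_clique_neq[OF params _ assms(9,10,14)]
    by simp
  note pairs = this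
  \<comment> \<open>Conjugation is a fixed-point-free involution on the cliques.\<close>
  have "even (card (subspace_cliques K X (?Q\<^sup>2)))"
    by (rule even_card_involution[OF _ pairs]) auto
  with pairs show ?thesis unfolding Q2 by blast
qed

end
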